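(* Let $\mathfrak X$ be a topological space. Then the formula $DS$, i.e. $[\neq]p\to\Diamond p$ (with $p$ a propositional letter), is valid in $\mathfrak X$ if and only if $\mathfrak X$ is dense-in-itself.
   Context: Formulas are built by $\phi ::= p \mid \bot \mid \phi\to\phi \mid \Box\phi \mid [\neq]\phi$, with $p$ ranging over propositional letters; $\neg$ is defined as usual and $\Diamond A=\neg\Box\neg A$. A valuation $\theta$ on a topological space $\mathfrak X$ assigns to each propositional letter a subset of $\mathfrak X$. Truth at a point is defined by: $\mathfrak X,\theta,x\models p$ iff $x\in\theta(p)$; $\bot$ is never true; $\to$ is interpreted classically; $\mathfrak X,\theta,x\models\Box\phi$ iff there is a neighborhood $U$ of $x$ with $\mathfrak X,\theta,y\models\phi$ for all $y\in U$; $\mathfrak X,\theta,x\models[\neq]\phi$ iff $\mathfrak X,\theta,y\models\phi$ for all $y\neq x$. A formula is valid in $\mathfrak X$ if it is true at every point under every valuation. A point $x$ is isolated if $\{x\}$ is open; $\mathfrak X$ is dense-in-itself if it has no isolated points. *)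

theory Defs
  imports "HOL-Analysis.Analysis"
begin

datatype 'p fm =
    Letter 'p
  | Bot
  | Imp "'p fm" "'p fm"  (infixr "\<^bold>\<rightarrow>" 25)
  | Box "'p fm"
  | DBox "'p fm"

definition Neg :: "'p fm \<Rightarrow> 'p fm" where
  "Neg A = (A \<^bold>\<rightarrow> Bot)"

definition Dia :: "'p fm \<Rightarrow> 'p fm" where
  "Dia A = Neg (Box (Neg A))"

text \<open>A neighborhood of a point is not required to be open.\<close>

definition neighborhood_of :: "'a topology \<Rightarrow> 'a \<Rightarrow> 'a set \<Rightarrow> bool" where
  "neighborhood_of X x U \<longleftrightarrow>
     U \<subseteq> topspace X \<and> (\<exists>V. openin X V \<and> x \<in> V \<and> V \<subseteq> U)"

definition valuation :: "'a topology \<Rightarrow> ('p \<Rightarrow> 'a set) \<Rightarrow> bool" where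
  "valuation X \<theta> \<longleftrightarrow> (\<forall>p. \<theta> p \<subseteq> topspace X)"

text \<open>The clause for \<^const>\<open>DBox\<close>, the difference modality, ranges over the points of the
  space, not over the whole carrier type.\<close>

primrec sat :: "'a topology \<Rightarrow> ('p \<Rightarrow> 'a set) \<Rightarrow> 'a \<Rightarrow> 'p fm \<Rightarrow> bool" where
  "sat X \<theta> x (Letter p) \<longleftrightarrow> x \<in> \<theta> p"
| "sat X \<theta> x Bot \<longleftrightarrow> False"
| "sat X \<theta> x (A \<^bold>\<rightarrow> B) \<longleftrightarrow> (sat X \<theta> x A \<longrightarrow> sat X \<theta> x B)"
| "sat X \<theta> x (Box A) \<longleftrightarrow> (\<exists>U. neighborhood_of X x U \<and> (\<forall>y\<in>U. sat X \<theta> y A))"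
| "sat X \<theta> x (DBox A) \<longleftrightarrow> (\<forall>y\<in>topspace X. y \<noteq> x \<longrightarrow> sat X \<theta> y A)"

definition valid_in :: "'a topology \<Rightarrow> 'p fm \<Rightarrow> bool" where
  "valid_in X A \<longleftrightarrow> (\<forall>\<theta>. valuation X \<theta> \<longrightarrow> (\<forall>x\<in>topspace X. sat X \<theta> x A))"

definition isolated_point :: "'a topology \<Rightarrow> 'a \<Rightarrow> bool" where
  "isolated_point X x \<longleftrightarrow> x \<in> topspace X \<and> openin X {x}"

definition dense_in_itself :: "'a topology \<Rightarrow> bool" where
  "dense_in_itself X \<longleftrightarrow> (\<nexists>x. isolated_point X x)"

definition DS :: "'p \<Rightarrow> 'p fm" where
  "DS p = (DBox (Letter p) \<^bold>\<rightarrow> Dia (Letter p))"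

end

theory Submission
  imports Defs
begin

text \<open>If \<open>[\<noteq>]p\<close> holds at \<open>x\<close>, then \<open>p\<close> can fail
  only at \<open>x\<close>, so the only neighborhood of \<open>x\<close> that could miss
  \<open>p\<close> is \<open>{x}\<close>. It is a neighborhood exactly when \<open>x\<close> is
  isolated. Hence an isolated point yields a countermodel, and without isolated points every
  neighborhood of \<open>x\<close> meets \<open>p\<close>. \<open>sat_Dia\<close> supplies this
  reading of the diamond as topological closure.\<close>

lemma sat_Dia:
  "sat X \<theta> x (Dia A) \<longleftrightarrow> (\<forall>U. neighborhood_of X x U \<longrightarrow> (\<exists>y\<in>U. sat X \<theta> y A))"
  by (auto simp: Dia_def Neg_def)

theorem lemma3p7:
  fixes X :: "'a topology" and p :: 'p
  shows "valid_in X (DS p) \<longleftrightarrow> dense_in_itself X"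
proof
  assume valid: "valid_in X (DS p)"
  have False if "isolated_point X x" for x
  proof -
    from that have x: "x \<in> topspace X" and "openin X {x}"
      by (auto simp: isolated_point_def)
    then have nbhd: "neighborhood_of X x {x}"
      unfolding neighborhood_of_def by blast
    \<comment> \<open>Removing just \<open>x\<close> makes \<open>[\<noteq>]p\<close> true at
      \<open>x\<close> while leaving no \<open>p\<close>-point in \<open>{x}\<close>. The other
      letters do not occur in \<open>DS p\<close>, so one value serves for all.\<close>
    define \<theta> :: "'p \<Rightarrow> 'a set" where "\<theta> = (\<lambda>_. topspace X - {x})"
    have "valuation X \<theta>"
      by (auto simp: valuation_def \<theta>_def)
    with valid x have "sat X \<theta> x (DS p)"
      by (simp add: valid_in_def)
    moreover have "sat X \<theta> x (DBox (Letter p))"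
      by (simp add: \<theta>_def)
    ultimately have "sat X \<theta> x (Dia (Letter p))"
      by (simp add: DS_def)
    with nbhd show False
      by (auto simp: sat_Dia \<theta>_def)
  qed
  then show "dense_in_itself X"
    by (auto simp: dense_in_itself_def)
next
  assume dense: "dense_in_itself X"
  have "sat X \<theta> x (Dia (Letter p))"
    if x: "x \<in> topspace X" and dbox: "sat X \<theta> x (DBox (Letter p))"
    for \<theta> :: "'p \<Rightarrow> 'a set" and x
    unfolding sat_Dia
  proof (intro allI impI)
    fix U
    assume "neighborhood_of X x U"
    then obtain V where V: "openin X V" "x \<in> V" "V \<subseteq> U"
      by (auto simp: neighborhood_of_def)
    \<comment> \<open>Openness matters here: the argument runs in \<open>V\<close>, since
      \<open>U\<close> itself need not be open.\<close>
    from dense x V have "V \<noteq> {x}"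
      by (auto simp: dense_in_itself_def isolated_point_def)
    with V obtain y where "y \<in> V" "y \<noteq> x"
      by blast
    \<comment> \<open>The premise \<open>dbox\<close> speaks only of points of the space;
      \<open>y\<close> is one because \<open>V\<close> is open.\<close>
    with dbox V show "\<exists>y\<in>U. sat X \<theta> y (Letter p)"
      using openin_subset by fastforce
  qed
  then show "valid_in X (DS p)"
    by (simp add: valid_in_def DS_def)
qed

end
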